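(* Let $M$ be a finitely generated Garside monoid, equipped with a length $\ell_S$. Then the metrics $d_1$ and $d_3$ on $M$ are uniformly equivalent.
   Context: $a\preceq b$ means $b=ac$ for some $c\in M$; $b$ is a factor of $a$ if $a=cbd$ for some $c,d\in M$. A monoid $M$ is atomic if there is a norm $\nu:M\to\mathbb N$ with $\nu(a)>0$ for $a\neq1$ and $\nu(ab)\ge\nu(a)+\nu(b)$. $M$ is preGarside if it is atomic, left and right cancellative, any $a,b\in M$ having a common right multiple have a least one (for $\preceq$), and any $a,b$ having a common left multiple have a least one (for right divisibility). An element is balanced if its sets of left divisors and of right divisors coincide (and then equal its set of factors). A Garside element is a balanced element whose set of factors generates $M$; a Garside monoid is a preGarside monoid with a Garside element, and we fix one, $\Delta$. $S=\mathcal S(M)$ is the (finite) set of atoms. A length $\ell_S:M\to\mathbb N$ is a map with $\ell_S(ab)=\ell_S(a)+\ell_S(b)$, $\ell_S(a)>0$ for $a\ne1$ and $\ell_S(s)=1$ for all $s\in S$. In the Garside case, $M_{\mathrm{red}}=\{u\in M:u\preceq\Delta\}$, and for $u\in M$, $\alpha(u)=u\wedge\Delta$ is the greatest common left divisor of $u$ and $\Delta$, i.e. the greatest element for $\preceq$ of $\{v\in M_{\mathrm{red}}:v\preceq u\}$. Greedy normal form: for $u\neq1$, $\iota_1(u)=(u_1,\dots,u_n)$ is the unique sequence in $M_{\mathrm{red}}\setminus\{1\}$ with $u=u_1\cdots u_n$ and $u_i=\alpha(u_i\cdots u_n)$ for all $i$; $\iota_1(1)$ is the empty sequence. Prefix form: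 $\mathrm{Pref}_k(u)=\{v\in M: v\preceq u,\ \ell_S(v)=k\}$; for $u\ne1$, $\iota_3(u)=(\mathrm{Pref}_1(u),\dots,\mathrm{Pref}_{\ell_S(u)}(u))$, and $\iota_3(1)=(\{1\})$. For $i\in\{1,3\}$ and $u\ne v$, $r_i(u,v)$ is the largest $k\ge0$ such that $\iota_i(u),\iota_i(v)$ both have at least $k$ terms and agree in their first $k$ terms; $r_i(u,u)=\infty$; $d_i(u,v)=2^{-r_i(u,v)}$ with $2^{-\infty}=0$. Two metrics $d,d'$ on $X$ are uniformly equivalent if the identity maps $(X,d)\to(X,d')$ and $(X,d')\to(X,d)$ are both uniformly continuous. *)

theory Defs
  imports "HOL-Algebra.Divisibility" "HOL-Analysis.Abstract_Metric_Spaces"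
    "HOL-Library.Extended_Nat"
begin

text \<open>The relation \<open>a divides\<^bsub>M\<^esub> b\<close> of \<open>HOL-Algebra\<close> means \<open>b = a \<otimes> c\<close> for some \<open>c\<close>;
  in a non-commutative monoid this is left divisibility.\<close>

definition right_divides :: "('a, 'b) monoid_scheme \<Rightarrow> 'a \<Rightarrow> 'a \<Rightarrow> bool"
  where "right_divides M a b \<longleftrightarrow> (\<exists>c\<in>carrier M. b = c \<otimes>\<^bsub>M\<^esub> a)"

definition left_divisors :: "('a, 'b) monoid_scheme \<Rightarrow> 'a \<Rightarrow> 'a set"
  where "left_divisors M a = {b \<in> carrier M. b divides\<^bsub>M\<^esub> a}"

definition right_divisors :: "('a, 'b) monoid_scheme \<Rightarrow> 'a \<Rightarrow> 'a set"
  where "right_divisors M a = {b \<in> carrier M. right_divides M b a}"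

definition factor_set :: "('a, 'b) monoid_scheme \<Rightarrow> 'a \<Rightarrow> 'a set"
  where "factor_set M a =
    {b \<in> carrier M. \<exists>c\<in>carrier M. \<exists>d\<in>carrier M. a = c \<otimes>\<^bsub>M\<^esub> b \<otimes>\<^bsub>M\<^esub> d}"

definition atoms :: "('a, 'b) monoid_scheme \<Rightarrow> 'a set"
  where "atoms M = {a \<in> carrier M. a \<noteq> \<one>\<^bsub>M\<^esub> \<and>
    (\<forall>b\<in>carrier M. \<forall>c\<in>carrier M. a = b \<otimes>\<^bsub>M\<^esub> c \<longrightarrow> b = \<one>\<^bsub>M\<^esub> \<or> c = \<one>\<^bsub>M\<^esub>)}"

definition generates :: "('a, 'b) monoid_scheme \<Rightarrow> 'a set \<Rightarrow> bool"
  where "generates M A \<longleftrightarrow>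
    A \<subseteq> carrier M \<and> (\<forall>H. submonoid H M \<and> A \<subseteq> H \<longrightarrow> H = carrier M)"

definition finitely_generated :: "('a, 'b) monoid_scheme \<Rightarrow> bool"
  where "finitely_generated M \<longleftrightarrow> (\<exists>A. finite A \<and> generates M A)"

locale pregarside_monoid = monoid_cancel M for M (structure) +
  assumes atomic: "\<exists>\<nu> :: 'a \<Rightarrow> nat.
      (\<forall>a\<in>carrier M. a \<noteq> \<one> \<longrightarrow> \<nu> a > 0) \<and>
      (\<forall>a\<in>carrier M. \<forall>b\<in>carrier M. \<nu> (a \<otimes> b) \<ge> \<nu> a + \<nu> b)"
    and ex_right_lcm: "\<lbrakk>a \<in> carrier M; b \<in> carrier M;
        \<exists>m\<in>carrier M. a divides m \<and> b divides m\<rbrakk> \<Longrightarrow>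
      \<exists>m\<in>carrier M. a divides m \<and> b divides m \<and>
        (\<forall>m'\<in>carrier M. a divides m' \<and> b divides m' \<longrightarrow> m divides m')"
    and ex_left_lcm: "\<lbrakk>a \<in> carrier M; b \<in> carrier M;
        \<exists>m\<in>carrier M. right_divides M a m \<and> right_divides M b m\<rbrakk> \<Longrightarrow>
      \<exists>m\<in>carrier M. right_divides M a m \<and> right_divides M b m \<and>
        (\<forall>m'\<in>carrier M. right_divides M a m' \<and> right_divides M b m' \<longrightarrow> right_divides M m m')"

definition balanced :: "('a, 'b) monoid_scheme \<Rightarrow> 'a \<Rightarrow> bool"
  where "balanced M a \<longleftrightarrow> a \<in> carrier M \<and> left_divisors M a = right_divisors M a"

definition garside_element :: "('a, 'b) monoid_scheme \<Rightarrow> 'a \<Rightarrow> bool"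
  where "garside_element M a \<longleftrightarrow> balanced M a \<and> generates M (factor_set M a)"

locale garside_monoid = pregarside_monoid M for M (structure) +
  fixes \<Delta> :: 'a
  assumes garside: "garside_element M \<Delta>"

definition is_length :: "('a, 'b) monoid_scheme \<Rightarrow> ('a \<Rightarrow> nat) \<Rightarrow> bool"
  where "is_length M l \<longleftrightarrow>
    (\<forall>a\<in>carrier M. \<forall>b\<in>carrier M. l (a \<otimes>\<^bsub>M\<^esub> b) = l a + l b) \<and>
    (\<forall>a\<in>carrier M. a \<noteq> \<one>\<^bsub>M\<^esub> \<longrightarrow> l a > 0) \<and>
    (\<forall>s\<in>atoms M. l s = 1)"

text \<open>The argument \<open>\<Delta>\<close> below is the chosen Garside element.\<close>

definition M_red :: "('a, 'b) monoid_scheme \<Rightarrow> 'a \<Rightarrow> 'a set"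
  where "M_red M \<Delta> = {u \<in> carrier M. u divides\<^bsub>M\<^esub> \<Delta>}"

definition alpha :: "('a, 'b) monoid_scheme \<Rightarrow> 'a \<Rightarrow> 'a \<Rightarrow> 'a"
  where "alpha M \<Delta> u = (THE v. v \<in> M_red M \<Delta> \<and> v divides\<^bsub>M\<^esub> u \<and>
    (\<forall>w\<in>M_red M \<Delta>. w divides\<^bsub>M\<^esub> u \<longrightarrow> w divides\<^bsub>M\<^esub> v))"

definition list_product :: "('a, 'b) monoid_scheme \<Rightarrow> 'a list \<Rightarrow> 'a"
  where "list_product M us = foldr (\<otimes>\<^bsub>M\<^esub>) us \<one>\<^bsub>M\<^esub>"

definition is_greedy_normal_form ::
    "('a, 'b) monoid_scheme \<Rightarrow> 'a \<Rightarrow> 'a \<Rightarrow> 'a list \<Rightarrow> bool"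
  where "is_greedy_normal_form M \<Delta> u us \<longleftrightarrow>
    set us \<subseteq> M_red M \<Delta> - {\<one>\<^bsub>M\<^esub>} \<and>
    u = list_product M us \<and>
    (\<forall>i<length us. us ! i = alpha M \<Delta> (list_product M (drop i us)))"

definition iota1 :: "('a, 'b) monoid_scheme \<Rightarrow> 'a \<Rightarrow> 'a \<Rightarrow> 'a list"
  where "iota1 M \<Delta> u =
    (if u = \<one>\<^bsub>M\<^esub> then [] else (THE us. is_greedy_normal_form M \<Delta> u us))"

definition Pref :: "('a, 'b) monoid_scheme \<Rightarrow> ('a \<Rightarrow> nat) \<Rightarrow> nat \<Rightarrow> 'a \<Rightarrow> 'a set"
  where "Pref M l k u = {v \<in> carrier M. v divides\<^bsub>M\<^esub> u \<and> l v = k}"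

definition iota3 :: "('a, 'b) monoid_scheme \<Rightarrow> ('a \<Rightarrow> nat) \<Rightarrow> 'a \<Rightarrow> 'a set list"
  where "iota3 M l u =
    (if u = \<one>\<^bsub>M\<^esub> then [{\<one>\<^bsub>M\<^esub>}] else map (\<lambda>k. Pref M l k u) [1..<Suc (l u)])"

definition agreement :: "('a \<Rightarrow> 'c list) \<Rightarrow> 'a \<Rightarrow> 'a \<Rightarrow> enat"
  where "agreement \<iota> u v =
    (if u = v then \<infinity>
     else enat (GREATEST k. k \<le> length (\<iota> u) \<and> k \<le> length (\<iota> v) \<and>
                            take k (\<iota> u) = take k (\<iota> v)))"

definition agreement_dist :: "('a \<Rightarrow> 'c list) \<Rightarrow> 'a \<Rightarrow> 'a \<Rightarrow> real"
  where "agreement_dist \<iota> u v =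
    (case agreement \<iota> u v of enat k \<Rightarrow> 1 / 2 ^ k | \<infinity> \<Rightarrow> 0)"

definition d1 :: "('a, 'b) monoid_scheme \<Rightarrow> 'a \<Rightarrow> 'a \<Rightarrow> 'a \<Rightarrow> real"
  where "d1 M \<Delta> = agreement_dist (iota1 M \<Delta>)"

definition d3 :: "('a, 'b) monoid_scheme \<Rightarrow> ('a \<Rightarrow> nat) \<Rightarrow> 'a \<Rightarrow> 'a \<Rightarrow> real"
  where "d3 M l = agreement_dist (iota3 M l)"

text \<open>\<open>metric (X, d)\<close> is meaningful only if \<open>d\<close> is a metric on \<open>X\<close>, so this is
  made part of the definition.\<close>

definition uniformly_equivalent ::
    "'a set \<Rightarrow> ('a \<Rightarrow> 'a \<Rightarrow> real) \<Rightarrow> ('a \<Rightarrow> 'a \<Rightarrow> real) \<Rightarrow> bool"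
  where "uniformly_equivalent X d d' \<longleftrightarrow>
    Metric_space X d \<and> Metric_space X d' \<and>
    uniformly_continuous_map (metric (X, d)) (metric (X, d')) id \<and>
    uniformly_continuous_map (metric (X, d')) (metric (X, d)) id"

end

theory Submission
  imports Defs
begin

text \<open>
  Call a left divisor of \<open>\<Delta>\<close> simple, and let \<open>u\<^sub>1, u\<^sub>2, \<dots>\<close> be the greedy normal form of \<open>u\<close>.
  The whole proof rests on one property of this form: \<^emph>\<open>a product of \<open>k\<close> simple elements
  that divides \<open>u\<close> on the left divides \<open>u\<^sub>1 \<cdots> u\<^sub>k\<close>\<close> (\<open>greedy_absorbs_simple_product\<close>).
  Thus the first \<open>k\<close> greedy factors and the products of at most \<open>k\<close> simple elements dividing
  \<open>u\<close> determine each other. The property is proved by induction on \<open>k\<close>; in the step a simple \<open>s\<close>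
  divides \<open>q u'\<close> and must be shown to divide \<open>q \<alpha>(u')\<close>. As \<open>\<Delta>\<close> is balanced,
  \<open>q \<Delta>\<close> is a multiple of \<open>\<Delta>\<close> and so of \<open>s\<close>; hence the least common multiple of \<open>q\<close> and \<open>s\<close> is
  \<open>q t\<close> with \<open>t\<close> dividing both \<open>\<Delta>\<close> and \<open>u'\<close>, that is, \<open>t\<close> divides \<open>\<alpha>(u')\<close>.

  From \<open>d\<^sub>1\<close> to \<open>d\<^sub>3\<close>: an element of length \<open>k\<close> is a product of at most \<open>k\<close> non-trivial simple
  elements, so the prefixes of \<open>u\<close> of length at most \<open>n\<close> all divide \<open>u\<^sub>1 \<cdots> u\<^sub>n\<close>. Two elements with
  the same first \<open>n\<close> greedy factors therefore have the same prefixes up to length \<open>n\<close>.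

  From \<open>d\<^sub>3\<close> to \<open>d\<^sub>1\<close>: a simple element has length at most \<open>L = \<ell>\<^sub>S(\<Delta>)\<close>, so for \<open>j \<le> n\<close> the
  product \<open>u\<^sub>1 \<cdots> u\<^sub>j\<close> has length at most \<open>n L\<close>. If \<open>u\<close> and \<open>v\<close> have the same prefixes up to length
  \<open>n L\<close>, then \<open>u\<^sub>1 \<cdots> u\<^sub>j\<close> divides \<open>v\<close> and so \<open>v\<^sub>1 \<cdots> v\<^sub>j\<close>; by symmetry the two products are
  equal, and cancellation yields \<open>u\<^sub>j = v\<^sub>j\<close> for all \<open>j \<le> n\<close>.

  That \<open>d\<^sub>1\<close> and \<open>d\<^sub>3\<close> are metrics has nothing to do with monoids: the length of the common
  initial segment of two sequences always defines an ultrametric.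
\<close>

section \<open>The ultrametric of common initial segments\<close>

lemma enat_le_agreement_iff:
  "enat k \<le> agreement \<iota> u v \<longleftrightarrow>
    u = v \<or> k \<le> length (\<iota> u) \<and> k \<le> length (\<iota> v) \<and> take k (\<iota> u) = take k (\<iota> v)"
proof (cases "u = v")
  case True
  then show ?thesis by (simp add: agreement_def)
next
  case False
  define P where "P k \<longleftrightarrow> k \<le> length (\<iota> u) \<and> k \<le> length (\<iota> v) \<and> take k (\<iota> u) = take k (\<iota> v)" for k
  have bound: "\<And>k. P k \<Longrightarrow> k \<le> length (\<iota> u)" by (simp add: P_def)
  have "P 0" by (simp add: P_def)
  then have G: "P (Greatest P)" by (rule GreatestI_nat) (use bound in blast)
  have down: "P j" if "P i" "j \<le> i" for i j
  proof -
    have "take j (take i (\<iota> u)) = take j (take i (\<iota> v))" using that by (simp add: P_def)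
    then have "take j (\<iota> u) = take j (\<iota> v)" using that by (simp add: min_absorb1)
    with that show ?thesis by (simp add: P_def)
  qed
  have "k \<le> Greatest P \<longleftrightarrow> P k"
    using down[OF G] Greatest_le_nat[of P k "length (\<iota> u)"] bound by blast
  moreover have "agreement \<iota> u v = enat (Greatest P)"
    using False by (simp add: agreement_def P_def[abs_def])
  ultimately show ?thesis using False by (simp add: P_def)
qed

lemma agreement_commute: "agreement \<iota> u v = agreement \<iota> v u"
proof -
  have "(\<lambda>k. k \<le> length (\<iota> u) \<and> k \<le> length (\<iota> v) \<and> take k (\<iota> u) = take k (\<iota> v)) =
    (\<lambda>k. k \<le> length (\<iota> v) \<and> k \<le> length (\<iota> u) \<and> take k (\<iota> v) = take k (\<iota> u))"
    by auto
  then show ?thesis by (simp add: agreement_def)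
qed

lemma agreement_dist_le_iff: "agreement_dist \<iota> u v \<le> 1 / 2 ^ k \<longleftrightarrow> enat k \<le> agreement \<iota> u v"
  by (cases "agreement \<iota> u v") (auto simp: agreement_dist_def field_simps)

lemma Metric_space_agreement_dist: "Metric_space X (agreement_dist \<iota>)"
proof
  show "0 \<le> agreement_dist \<iota> x y" for x y
    by (auto simp: agreement_dist_def split: enat.split)
  show "agreement_dist \<iota> x y = agreement_dist \<iota> y x" for x y
    by (simp add: agreement_dist_def agreement_commute)
  show "agreement_dist \<iota> x y = 0 \<longleftrightarrow> x = y" for x y
    by (auto simp: agreement_dist_def agreement_def split: enat.split)
  show "agreement_dist \<iota> x z \<le> agreement_dist \<iota> x y + agreement_dist \<iota> y z" for x y z
  proof (cases "x = y \<or> y = z")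
    case True
    then show ?thesis by (auto simp: agreement_dist_def agreement_def)
  next
    case False
    then obtain a b where ab: "agreement \<iota> x y = enat a" "agreement \<iota> y z = enat b"
      by (auto simp: agreement_def)
    define k where "k = min a b"
    have "enat k \<le> agreement \<iota> x y" "enat k \<le> agreement \<iota> y z" by (auto simp: ab k_def)
    with False have "enat k \<le> agreement \<iota> x z" by (auto simp: enat_le_agreement_iff)
    then have "agreement_dist \<iota> x z \<le> 1 / 2 ^ k" by (simp add: agreement_dist_le_iff)
    also have "\<dots> \<le> 1 / 2 ^ a + 1 / 2 ^ b" by (cases "a \<le> b") (auto simp: k_def min_def)
    finally show ?thesis by (simp add: agreement_dist_def ab)
  qed
qed

text \<open>Since the non-zero distances are powers of \<open>1/2\<close>, a modulus of uniform continuity is a function \<open>f\<close>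
  such that agreement of \<open>f n\<close> terms forces agreement of \<open>n\<close> terms.\<close>

lemma uniformly_continuous_agreement_dist:
  assumes "\<And>n u v. \<lbrakk>u \<in> X; v \<in> X; enat (f n) \<le> agreement \<iota> u v\<rbrakk> \<Longrightarrow> enat n \<le> agreement \<iota>' u v"
  shows "uniformly_continuous_map (metric (X, agreement_dist \<iota>)) (metric (X, agreement_dist \<iota>')) id"
proof -
  interpret A: Metric_space X "agreement_dist \<iota>" by (rule Metric_space_agreement_dist)
  interpret B: Metric_space X "agreement_dist \<iota>'" by (rule Metric_space_agreement_dist)
  have "\<exists>\<delta>>0. \<forall>x\<in>X. \<forall>y\<in>X. agreement_dist \<iota> y x < \<delta> \<longrightarrow> agreement_dist \<iota>' y x < \<epsilon>"
    if "\<epsilon> > 0" for \<epsilon>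
  proof -
    obtain n where "(1/2::real) ^ n < \<epsilon>"
      using real_arch_pow_inv[OF \<open>\<epsilon> > 0\<close>, of "1/2"] by auto
    then have n: "1 / 2 ^ n < \<epsilon>" by (simp add: power_one_over)
    have "agreement_dist \<iota>' y x < \<epsilon>"
      if "x \<in> X" "y \<in> X" "agreement_dist \<iota> y x < 1 / 2 ^ f n" for x y
    proof -
      have "enat (f n) \<le> agreement \<iota> y x"
        using that(3) by (simp flip: agreement_dist_le_iff)
      then have "agreement_dist \<iota>' y x \<le> 1 / 2 ^ n"
        using assms that by (simp add: agreement_dist_le_iff)
      with n show ?thesis by linarith
    qed
    then show ?thesis by (intro exI[of _ "1 / 2 ^ f n"]) auto
  qed
  then show ?thesis by (simp add: uniformly_continuous_map_def)
qed

section \<open>Products of lists\<close>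

context monoid
begin

lemma list_product_Nil [simp]: "list_product G [] = \<one>"
  and list_product_Cons [simp]: "list_product G (x # xs) = x \<otimes> list_product G xs"
  by (simp_all add: list_product_def)

lemma list_product_closed [simp, intro]:
  "set xs \<subseteq> carrier G \<Longrightarrow> list_product G xs \<in> carrier G"
  by (induction xs) auto

lemma list_product_append:
  "\<lbrakk>set xs \<subseteq> carrier G; set ys \<subseteq> carrier G\<rbrakk> \<Longrightarrow>
    list_product G (xs @ ys) = list_product G xs \<otimes> list_product G ys"
  by (induction xs) (auto simp: m_assoc)

lemma list_product_take_drop:
  assumes "set xs \<subseteq> carrier G"
  shows "list_product G (take k xs) \<otimes> list_product G (drop k xs) = list_product G xs"
  using list_product_append[of "take k xs" "drop k xs"] assms
    set_take_subset[of k xs] set_drop_subset[of k xs] by auto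

end

section \<open>Simple elements and the greatest simple left divisor\<close>

locale garside_monoid_with_length = garside_monoid M \<Delta> for M (structure) and \<Delta> +
  fixes l :: "'a \<Rightarrow> nat"
  assumes is_length: "is_length M l"
begin

lemma length_mult: "\<lbrakk>a \<in> carrier M; b \<in> carrier M\<rbrakk> \<Longrightarrow> l (a \<otimes> b) = l a + l b"
  and length_pos: "\<lbrakk>a \<in> carrier M; a \<noteq> \<one>\<rbrakk> \<Longrightarrow> l a > 0"
  using is_length by (auto simp: is_length_def)

lemma length_one [simp]: "l \<one> = 0"
  using length_mult[of \<one> \<one>] by simp

lemma length_mono:
  assumes "a divides b" "a \<in> carrier M"
  shows "l a \<le> l b"
  using assms by (auto simp: length_mult elim!: dividesE)

lemma divides_same_length_imp_eq:
  assumes "a divides b" "a \<in> carrier M" "l b \<le> l a"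
  shows "a = b"
proof -
  obtain c where c: "c \<in> carrier M" "b = a \<otimes> c" using assms(1) by (auto elim: dividesE)
  then have "l c = 0" using assms by (simp add: length_mult)
  with c length_pos assms(2) show ?thesis by fastforce
qed

lemma one_divides: "a \<in> carrier M \<Longrightarrow> \<one> divides a"
  by (rule dividesI[of a]) auto

lemma divides_antisym:
  "\<lbrakk>a divides b; b divides a; a \<in> carrier M; b \<in> carrier M\<rbrakk> \<Longrightarrow> a = b"
  by (simp add: divides_same_length_imp_eq length_mono)

lemma Delta_closed [simp, intro]: "\<Delta> \<in> carrier M"
  and Delta_balanced: "\<lbrakk>a \<in> carrier M; right_divides M a \<Delta>\<rbrakk> \<Longrightarrow> a divides \<Delta>"
  and generated_by_factors: "generates M (factor_set M \<Delta>)"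
  using garside by (auto simp: garside_element_def balanced_def left_divisors_def right_divisors_def)

lemma M_red_closed: "a \<in> M_red M \<Delta> \<Longrightarrow> a \<in> carrier M"
  and M_red_divides: "a \<in> M_red M \<Delta> \<Longrightarrow> a divides \<Delta>"
  by (auto simp: M_red_def)

text \<open>If \<open>\<Delta> = c b d\<close>, then \<open>b d\<close> is a right divisor of \<open>\<Delta>\<close>, and so a left divisor.\<close>

lemma factor_set_Delta: "factor_set M \<Delta> \<subseteq> M_red M \<Delta>"
proof
  fix b assume "b \<in> factor_set M \<Delta>"
  then obtain c d where *: "b \<in> carrier M" "c \<in> carrier M" "d \<in> carrier M" "\<Delta> = c \<otimes> b \<otimes> d"
    by (auto simp: factor_set_def)
  then have "right_divides M (b \<otimes> d) \<Delta>" by (auto simp: right_divides_def m_assoc)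
  then have "b \<otimes> d divides \<Delta>" using * by (intro Delta_balanced) auto
  moreover have "b divides b \<otimes> d" using * by (auto intro: dividesI)
  ultimately show "b \<in> M_red M \<Delta>" using * by (auto simp: M_red_def intro: divides_trans)
qed

lemma generated_by_M_red:
  assumes "submonoid H M" "M_red M \<Delta> \<subseteq> H"
  shows "H = carrier M"
  using generated_by_factors factor_set_Delta assms unfolding generates_def by blast

lemma simple_product_exists:
  assumes "x \<in> carrier M"
  obtains xs where "set xs \<subseteq> M_red M \<Delta> - {\<one>}" "x = list_product M xs"
proof -
  define H where "H = list_product M ` {xs. set xs \<subseteq> M_red M \<Delta> - {\<one>}}"
  have closed: "set xs \<subseteq> carrier M" if "set xs \<subseteq> M_red M \<Delta> - {\<one>}" for xs
    using that M_red_closed by auto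
  have "submonoid H M"
  proof
    show "H \<subseteq> carrier M" using closed by (auto simp: H_def)
    show "\<one> \<in> H" unfolding H_def by (rule image_eqI[of _ _ "[]"]) auto
    fix x y assume "x \<in> H" "y \<in> H"
    then obtain xs ys where "x = list_product M xs" "y = list_product M ys"
      "set xs \<subseteq> M_red M \<Delta> - {\<one>}" "set ys \<subseteq> M_red M \<Delta> - {\<one>}"
      by (auto simp: H_def)
    then show "x \<otimes> y \<in> H"
      unfolding H_def by (intro image_eqI[of _ _ "xs @ ys"]) (auto simp: list_product_append closed)
  qed
  moreover have "a \<in> H" if "a \<in> M_red M \<Delta>" for a
  proof (cases "a = \<one>")
    case True
    then show ?thesis using \<open>submonoid H M\<close> by (auto simp: submonoid_def)
  next
    case False
    then show ?thesis unfolding H_def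
      using that by (intro image_eqI[of _ _ "[a]"]) (auto simp: M_red_closed)
  qed
  ultimately have "H = carrier M" by (intro generated_by_M_red) auto
  with assms that show thesis by (auto simp: H_def)
qed

lemma length_simple_product_ge:
  assumes "set xs \<subseteq> M_red M \<Delta> - {\<one>}"
  shows "length xs \<le> l (list_product M xs)"
  using assms
proof (induction xs)
  case (Cons x xs)
  then have "x \<in> carrier M" "set xs \<subseteq> carrier M" by (auto dest: M_red_closed)
  moreover have "l x > 0" using Cons.prems by (auto intro: length_pos M_red_closed)
  ultimately show ?case using Cons by (auto simp: length_mult)
qed simp

lemma length_simple_product_le:
  assumes "set xs \<subseteq> M_red M \<Delta>"
  shows "l (list_product M xs) \<le> length xs * l \<Delta>"
  using assms
proof (induction xs)
  case (Cons x xs)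
  then have "x \<in> carrier M" "set xs \<subseteq> carrier M" by (auto dest: M_red_closed)
  moreover have "l x \<le> l \<Delta>" using Cons.prems by (auto intro: length_mono M_red_closed M_red_divides)
  ultimately show ?case using Cons by (auto simp: length_mult)
qed simp

text \<open>For simple \<open>q\<close> write \<open>\<Delta> = q b\<close>; as \<open>b\<close> is also a left divisor, \<open>\<Delta> = b c\<close>, and
  \<open>q \<Delta> = q b c = \<Delta> c\<close>. The elements \<open>q\<close> with \<open>q \<Delta> \<in> \<Delta> M\<close> form a submonoid.\<close>

lemma Delta_divides_mult_Delta:
  assumes "q \<in> carrier M"
  shows "\<Delta> divides q \<otimes> \<Delta>"
proof -
  define H where "H = {q \<in> carrier M. \<Delta> divides q \<otimes> \<Delta>}"
  have "submonoid H M"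
  proof
    show "H \<subseteq> carrier M" by (auto simp: H_def)
    show "\<one> \<in> H" by (auto simp: H_def)
    fix x y assume "x \<in> H" "y \<in> H"
    then obtain c d where "x \<in> carrier M" "y \<in> carrier M" "c \<in> carrier M" "d \<in> carrier M"
      and c: "x \<otimes> \<Delta> = \<Delta> \<otimes> c" and d: "y \<otimes> \<Delta> = \<Delta> \<otimes> d"
      by (auto simp: H_def elim!: dividesE)
    note mem = this(1-4)
    have "(x \<otimes> y) \<otimes> \<Delta> = x \<otimes> (\<Delta> \<otimes> d)" using mem by (simp add: m_assoc d)
    also have "\<dots> = (\<Delta> \<otimes> c) \<otimes> d" using mem by (simp flip: m_assoc c)
    also have "\<dots> = \<Delta> \<otimes> (c \<otimes> d)" using mem by (simp add: m_assoc)
    finally show "x \<otimes> y \<in> H" using mem by (auto simp: H_def intro: dividesI)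
  qed
  moreover have "a \<in> H" if "a \<in> M_red M \<Delta>" for a
  proof -
    have a: "a \<in> carrier M" using that by (rule M_red_closed)
    obtain b where b: "b \<in> carrier M" "\<Delta> = a \<otimes> b"
      using M_red_divides[OF \<open>a \<in> M_red M \<Delta>\<close>] by (auto elim: dividesE)
    then have "b divides \<Delta>" using a by (intro Delta_balanced) (auto simp: right_divides_def)
    then obtain c where c: "c \<in> carrier M" "\<Delta> = b \<otimes> c" by (auto elim: dividesE)
    have "a \<otimes> \<Delta> = a \<otimes> (b \<otimes> c)" by (simp flip: c(2))
    also have "\<dots> = \<Delta> \<otimes> c" using a b c by (simp add: m_assoc)
    finally show ?thesis using a c by (auto simp: H_def intro: dividesI)
  qed
  ultimately have "H = carrier M" by (intro generated_by_M_red) auto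
  with assms show ?thesis by (auto simp: H_def)
qed

text \<open>A longest common left divisor \<open>v\<close> of \<open>u\<close> and \<open>\<Delta>\<close> is greatest: for any other one \<open>w\<close>,
  the least common multiple of \<open>v\<close> and \<open>w\<close> again divides \<open>u\<close> and \<open>\<Delta>\<close>, and so is no longer
  than \<open>v\<close>.\<close>

lemma greatest_simple_divisor_exists:
  assumes u: "u \<in> carrier M"
  shows "\<exists>v. v \<in> M_red M \<Delta> \<and> v divides u \<and> (\<forall>w\<in>M_red M \<Delta>. w divides u \<longrightarrow> w divides v)"
proof -
  define P where "P v \<longleftrightarrow> v \<in> M_red M \<Delta> \<and> v divides u" for v
  have "P \<one>" using u by (auto simp: P_def M_red_def one_divides)
  moreover have "\<forall>v. P v \<longrightarrow> l v < Suc (l u)"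
    by (auto simp: P_def less_Suc_eq_le intro: length_mono M_red_closed)
  ultimately obtain v where v: "P v" and max: "\<And>w. P w \<Longrightarrow> l w \<le> l v"
    using ex_has_greatest_nat[of P \<one> l] by blast
  have "w divides v" if w: "P w" for w
  proof -
    have mem: "v \<in> carrier M" "w \<in> carrier M" using v w by (auto simp: P_def M_red_closed)
    moreover have "v divides \<Delta>" "w divides \<Delta>" using v w by (auto simp: P_def M_red_divides)
    ultimately obtain m where m: "m \<in> carrier M" "v divides m" "w divides m"
      and least: "\<And>m'. \<lbrakk>m' \<in> carrier M; v divides m'; w divides m'\<rbrakk> \<Longrightarrow> m divides m'"
      using ex_right_lcm[of v w] by blast
    have "m divides u" "m divides \<Delta>"
      using v w u by (auto intro!: least simp: P_def M_red_divides)
    then have "P m" using m by (auto simp: P_def M_red_def)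
    then have "v = m" using max m mem by (intro divides_same_length_imp_eq) auto
    then show ?thesis using m by simp
  qed
  then show ?thesis using v by (auto simp: P_def)
qed

lemma alpha_greatest:
  assumes "u \<in> carrier M"
  shows alpha_M_red: "alpha M \<Delta> u \<in> M_red M \<Delta>"
    and alpha_divides: "alpha M \<Delta> u divides u"
    and divides_alpha: "\<And>w. \<lbrakk>w \<in> M_red M \<Delta>; w divides u\<rbrakk> \<Longrightarrow> w divides alpha M \<Delta> u"
proof -
  let ?P = "\<lambda>v. v \<in> M_red M \<Delta> \<and> v divides u \<and> (\<forall>w\<in>M_red M \<Delta>. w divides u \<longrightarrow> w divides v)"
  obtain v where "?P v" using greatest_simple_divisor_exists[OF assms] by blast
  then have "\<exists>!v. ?P v" by (intro ex1I[of _ v]) (auto intro: divides_antisym M_red_closed)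
  from theI'[OF this] have "?P (alpha M \<Delta> u)" by (simp add: alpha_def)
  then show "alpha M \<Delta> u \<in> M_red M \<Delta>" "alpha M \<Delta> u divides u"
    "\<And>w. \<lbrakk>w \<in> M_red M \<Delta>; w divides u\<rbrakk> \<Longrightarrow> w divides alpha M \<Delta> u"
    by auto
qed

lemma alpha_ne_one:
  assumes u: "u \<in> carrier M" "u \<noteq> \<one>"
  shows "alpha M \<Delta> u \<noteq> \<one>"
proof
  assume *: "alpha M \<Delta> u = \<one>"
  obtain xs where xs: "set xs \<subseteq> M_red M \<Delta> - {\<one>}" "u = list_product M xs"
    using simple_product_exists u by blast
  with u obtain x ys where Cons: "xs = x # ys" by (cases xs) auto
  with xs have x: "x \<in> carrier M" "set ys \<subseteq> carrier M" "x \<in> M_red M \<Delta>" "x \<noteq> \<one>"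
    by (auto dest: M_red_closed)
  then have "x divides u" using xs Cons by (auto intro: dividesI)
  then have "x divides \<one>" using divides_alpha[OF u(1)] x * by force
  then have "x = \<one>" using x by (intro divides_same_length_imp_eq) auto
  with x show False by simp
qed

text \<open>The least common multiple of \<open>q\<close> and \<open>s\<close> is \<open>q t\<close> for some \<open>t\<close>. It divides both common
  multiples \<open>q \<Delta>\<close> and \<open>q u\<close>; cancelling \<open>q\<close> shows that \<open>t\<close> divides \<open>\<Delta>\<close> and \<open>u\<close>.\<close>

lemma simple_divides_mult_alpha:
  assumes s: "s \<in> M_red M \<Delta>" and q: "q \<in> carrier M" and u: "u \<in> carrier M"
    and dvd: "s divides q \<otimes> u"
  shows "s divides q \<otimes> alpha M \<Delta> u"
proof -
  have s': "s \<in> carrier M" using s by (rule M_red_closed)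
  have "s divides q \<otimes> \<Delta>"
    using divides_trans[OF M_red_divides[OF s] Delta_divides_mult_Delta[OF q] s'] .
  have "\<exists>m\<in>carrier M. q divides m \<and> s divides m"
    using q u dvd by (intro bexI[of _ "q \<otimes> u"]) auto
  then obtain m where m: "m \<in> carrier M" "q divides m" "s divides m"
    and least: "\<And>m'. \<lbrakk>m' \<in> carrier M; q divides m'; s divides m'\<rbrakk> \<Longrightarrow> m divides m'"
    using ex_right_lcm[OF q s'] by blast
  obtain t where t: "t \<in> carrier M" "m = q \<otimes> t" using m(2) by (auto elim: dividesE)
  have "m divides q \<otimes> \<Delta>" "m divides q \<otimes> u"
    using q u dvd \<open>s divides q \<otimes> \<Delta>\<close> by (auto intro!: least)
  then have "t divides \<Delta>" "t divides u"
    using t q u by (auto simp: divides_mult_l)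
  then have "t divides alpha M \<Delta> u"
    using u t by (intro divides_alpha) (auto simp: M_red_def)
  then have "m divides q \<otimes> alpha M \<Delta> u"
    using t q u by (auto intro: divides_mult_lI)
  with m s' show ?thesis by (blast intro: divides_trans)
qed

section \<open>Greedy normal forms\<close>

lemma greedy_Nil: "is_greedy_normal_form M \<Delta> u [] \<longleftrightarrow> u = \<one>"
  by (simp add: is_greedy_normal_form_def)

lemma greedy_Cons:
  "is_greedy_normal_form M \<Delta> u (a # us) \<longleftrightarrow>
    a \<in> M_red M \<Delta> - {\<one>} \<and> u = a \<otimes> list_product M us \<and> a = alpha M \<Delta> u \<and>
    is_greedy_normal_form M \<Delta> (list_product M us) us"
  by (auto simp: is_greedy_normal_form_def All_less_Suc2)

lemma greedy_M_red: "is_greedy_normal_form M \<Delta> u us \<Longrightarrow> set us \<subseteq> M_red M \<Delta> - {\<one>}"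
  and greedy_list_product: "is_greedy_normal_form M \<Delta> u us \<Longrightarrow> list_product M us = u"
  and greedy_nth: "\<lbrakk>is_greedy_normal_form M \<Delta> u us; i < length us\<rbrakk> \<Longrightarrow>
    us ! i = alpha M \<Delta> (list_product M (drop i us))"
  unfolding is_greedy_normal_form_def by blast+

lemma greedy_closed: "is_greedy_normal_form M \<Delta> u us \<Longrightarrow> set us \<subseteq> carrier M"
  using greedy_M_red M_red_closed by blast

lemma greedy_exists:
  assumes "u \<in> carrier M"
  shows "\<exists>us. is_greedy_normal_form M \<Delta> u us"
  using assms
proof (induction "l u" arbitrary: u rule: less_induct)
  case less
  show ?case
  proof (cases "u = \<one>")
    case True
    then show ?thesis using greedy_Nil by blast
  next
    case False
    define a where "a = alpha M \<Delta> u"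
    have a: "a \<in> M_red M \<Delta>" "a \<noteq> \<one>" "a divides u"
      using less.prems False by (auto simp: a_def alpha_M_red alpha_divides alpha_ne_one)
    then obtain v where v: "v \<in> carrier M" "u = a \<otimes> v" by (auto elim: dividesE)
    then have "l v < l u" using a by (auto simp: length_mult M_red_closed length_pos)
    with less.hyps v obtain us where us: "is_greedy_normal_form M \<Delta> v us" by blast
    have "is_greedy_normal_form M \<Delta> u (a # us)"
      unfolding greedy_Cons greedy_list_product[OF us] using a v us a_def by blast
    then show ?thesis by blast
  qed
qed

lemma greedy_unique:
  assumes "is_greedy_normal_form M \<Delta> u us" "is_greedy_normal_form M \<Delta> u vs"
  shows "us = vs"
  using assms
proof (induction us arbitrary: u vs)
  case Nil
  then have "list_product M vs = \<one>" "set vs \<subseteq> M_red M \<Delta> - {\<one>}"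
    using greedy_list_product greedy_M_red by (auto simp: greedy_Nil)
  then show ?case using length_simple_product_ge[of vs] by simp
next
  case (Cons a us)
  then have "u \<noteq> \<one>"
    using length_simple_product_ge[OF greedy_M_red] by (fastforce dest: greedy_list_product)
  with Cons.prems obtain b ws where vs: "vs = b # ws"
    by (cases vs) (auto simp: greedy_Nil)
  have a: "a = alpha M \<Delta> u" "u = a \<otimes> list_product M us"
    "is_greedy_normal_form M \<Delta> (list_product M us) us"
    using Cons.prems(1) unfolding greedy_Cons by blast+
  have b: "b = alpha M \<Delta> u" "u = b \<otimes> list_product M ws"
    "is_greedy_normal_form M \<Delta> (list_product M ws) ws"
    using Cons.prems(2) unfolding vs greedy_Cons by blast+
  have ab: "b = a" by (simp only: a(1) b(1))
  have "set (a # us) \<subseteq> carrier M" "set ws \<subseteq> carrier M"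
    using greedy_closed Cons.prems(1) b(3) by blast+
  moreover have "a \<otimes> list_product M us = a \<otimes> list_product M ws"
    using a(2) b(2) unfolding ab by (rule subst)
  ultimately have "list_product M us = list_product M ws" by (simp add: l_cancel)
  then have "us = ws" using Cons.IH[OF a(3)] b(3) by simp
  then show ?case by (simp add: vs ab)
qed

lemma greedy_iota1:
  assumes "u \<in> carrier M"
  shows "is_greedy_normal_form M \<Delta> u (iota1 M \<Delta> u)"
proof (cases "u = \<one>")
  case True
  then show ?thesis by (simp add: iota1_def greedy_Nil)
next
  case False
  have "\<exists>!us. is_greedy_normal_form M \<Delta> u us"
    using greedy_exists[OF assms] greedy_unique by blast
  from theI'[OF this] show ?thesis using False by (simp add: iota1_def)
qed

lemma greedy_take_divides:
  assumes "is_greedy_normal_form M \<Delta> u us"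
  shows "list_product M (take k us) divides u"
proof -
  have "set us \<subseteq> carrier M" "u = list_product M us"
    using assms greedy_closed greedy_list_product by blast+
  then have "u = list_product M (take k us) \<otimes> list_product M (drop k us)"
    and "list_product M (drop k us) \<in> carrier M"
    using set_drop_subset[of k us] by (auto simp: list_product_take_drop)
  then show ?thesis by (auto intro: dividesI)
qed

text \<open>In the step, the product \<open>y\<close> of all but the last factor \<open>s\<close> divides the corresponding
  greedy product \<open>p = y q\<close>, and \<open>s\<close> divides \<open>q u'\<close>, where \<open>u = p u'\<close>. The next greedy factor is
  \<open>\<alpha>(u')\<close>.\<close>

lemma greedy_absorbs_simple_product:
  assumes us: "is_greedy_normal_form M \<Delta> u us"
    and "set xs \<subseteq> M_red M \<Delta>" "list_product M xs divides u"
  shows "list_product M xs divides list_product M (take (length xs) us)"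
  using assms(2,3)
proof (induction xs rule: rev_induct)
  case Nil
  then show ?case by simp
next
  case (snoc s ys)
  have closed: "set us \<subseteq> carrier M" "set ys \<subseteq> carrier M" and s: "s \<in> M_red M \<Delta>" "s \<in> carrier M"
    using snoc.prems greedy_closed[OF us] M_red_closed by auto
  have u: "u = list_product M us" using greedy_list_product[OF us] by simp
  define j where "j = length ys"
  define y where "y = list_product M ys"
  define p where "p = list_product M (take j us)"
  define u' where "u' = list_product M (drop j us)"
  have mem: "y \<in> carrier M" "p \<in> carrier M" "u' \<in> carrier M"
    using closed set_take_subset[of j us] set_drop_subset[of j us]
    by (auto simp: y_def p_def u'_def)
  have pu': "u = p \<otimes> u'" using closed by (simp add: p_def u'_def u list_product_take_drop)
  have ys: "list_product M (ys @ [s]) = y \<otimes> s"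
    using closed s by (simp add: list_product_append y_def)
  show ?case
  proof (cases "j < length us")
    case False
    then show ?thesis using snoc.prems(2) by (simp add: u j_def)
  next
    case True
    have "y divides y \<otimes> s" using mem s by auto
    then have "y divides u" using snoc.prems(2) mem s by (metis divides_trans ys)
    then have "y divides p" using snoc by (auto simp: y_def p_def j_def)
    then obtain q where q: "q \<in> carrier M" "p = y \<otimes> q" by (auto elim: dividesE)
    have "y \<otimes> s divides y \<otimes> (q \<otimes> u')" using snoc.prems(2) mem q by (simp add: ys pu' m_assoc)
    then have "s divides q \<otimes> u'" using mem q s by (simp add: divides_mult_l)
    then have "s divides q \<otimes> alpha M \<Delta> u'" using s q mem by (intro simple_divides_mult_alpha)
    then have "y \<otimes> s divides y \<otimes> (q \<otimes> alpha M \<Delta> u')"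
      using mem s q by (auto intro!: divides_mult_lI)
    also have "y \<otimes> (q \<otimes> alpha M \<Delta> u') = p \<otimes> alpha M \<Delta> u'"
      using mem q by (simp add: m_assoc M_red_closed alpha_M_red)
    also have "\<dots> = list_product M (take (Suc j) us)"
    proof -
      have "us ! j = alpha M \<Delta> u'" using greedy_nth[OF us True] by (simp add: u'_def)
      then show ?thesis
        using True closed set_take_subset[of j us] nth_mem[OF True]
        by (subst take_Suc_conv_app_nth, simp, subst list_product_append)
          (auto simp: p_def M_red_closed alpha_M_red mem)
    qed
    finally show ?thesis by (simp add: ys j_def)
  qed
qed

lemma iota1_M_red: "u \<in> carrier M \<Longrightarrow> set (iota1 M \<Delta> u) \<subseteq> M_red M \<Delta> - {\<one>}"
  and list_product_iota1: "u \<in> carrier M \<Longrightarrow> list_product M (iota1 M \<Delta> u) = u"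
  using greedy_iota1 greedy_M_red greedy_list_product by blast+

lemma list_product_take_iota1_closed:
  "u \<in> carrier M \<Longrightarrow> list_product M (take k (iota1 M \<Delta> u)) \<in> carrier M"
  using iota1_M_red[of u] M_red_closed set_take_subset[of k] by fastforce

section \<open>Comparison of the two forms\<close>

lemma length_iota3: "u \<noteq> \<one> \<Longrightarrow> length (iota3 M l u) = l u"
  by (simp add: iota3_def)

lemma nth_iota3: "\<lbrakk>u \<noteq> \<one>; i < l u\<rbrakk> \<Longrightarrow> iota3 M l u ! i = Pref M l (Suc i) u"
  by (simp add: iota3_def del: upt_Suc)

lemma Pref_subset_if_iota1_agree:
  assumes u: "u \<in> carrier M" and v: "v \<in> carrier M"
    and agree: "take n (iota1 M \<Delta> u) = take n (iota1 M \<Delta> v)" and "k \<le> n"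
  shows "Pref M l k u \<subseteq> Pref M l k v"
proof
  fix x assume "x \<in> Pref M l k u"
  then have x: "x \<in> carrier M" "x divides u" "l x = k" by (auto simp: Pref_def)
  obtain xs where xs: "set xs \<subseteq> M_red M \<Delta> - {\<one>}" "x = list_product M xs"
    using simple_product_exists[OF x(1)] .
  define j where "j = length xs"
  have "j \<le> n" using length_simple_product_ge[OF xs(1)] xs x \<open>k \<le> n\<close> by (simp add: j_def)
  then have "take j (take n (iota1 M \<Delta> u)) = take j (iota1 M \<Delta> u)"
    "take j (take n (iota1 M \<Delta> v)) = take j (iota1 M \<Delta> v)"
    by (simp_all add: min_absorb1)
  with agree have "take j (iota1 M \<Delta> u) = take j (iota1 M \<Delta> v)" by simp
  moreover have "x divides list_product M (take j (iota1 M \<Delta> u))"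
    using greedy_absorbs_simple_product[OF greedy_iota1[OF u], of xs] xs x by (auto simp: j_def)
  ultimately have "x divides v"
    using greedy_take_divides[OF greedy_iota1[OF v], of j] x by (auto intro: divides_trans)
  with x show "x \<in> Pref M l k v" by (simp add: Pref_def)
qed

lemma agreement_iota1_imp_iota3:
  assumes u: "u \<in> carrier M" and v: "v \<in> carrier M"
    and "enat n \<le> agreement (iota1 M \<Delta>) u v"
  shows "enat n \<le> agreement (iota3 M l) u v"
proof (cases "u = v \<or> n = 0")
  case True
  then show ?thesis by (auto simp: enat_le_agreement_iff)
next
  case False
  then have n: "n \<le> length (iota1 M \<Delta> u)" "n \<le> length (iota1 M \<Delta> v)"
    and agree: "take n (iota1 M \<Delta> u) = take n (iota1 M \<Delta> v)" and "n > 0"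
    using assms(3) by (auto simp: enat_le_agreement_iff)
  then have ne: "u \<noteq> \<one>" "v \<noteq> \<one>" by (auto simp: iota1_def)
  have len: "n \<le> l u" "n \<le> l v"
    using n length_simple_product_ge[OF iota1_M_red] u v by (fastforce simp: list_product_iota1)+
  have "take n (iota3 M l u) = take n (iota3 M l v)"
  proof (rule nth_equalityI)
    show "length (take n (iota3 M l u)) = length (take n (iota3 M l v))"
      using len ne by (simp add: length_iota3)
    fix i assume "i < length (take n (iota3 M l u))"
    then have "i < n" by simp
    moreover from this have "Pref M l (Suc i) u = Pref M l (Suc i) v"
      by (intro equalityI Pref_subset_if_iota1_agree[where n = n] u v agree agree[symmetric]) auto
    ultimately show "take n (iota3 M l u) ! i = take n (iota3 M l v) ! i"
      using len ne by (simp add: nth_iota3)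
  qed
  with len ne show ?thesis by (simp add: enat_le_agreement_iff length_iota3)
qed

lemma length_Delta_pos:
  assumes "u \<in> carrier M" "u \<noteq> \<one>"
  shows "l \<Delta> > 0"
proof -
  have a: "alpha M \<Delta> u \<in> M_red M \<Delta>" "alpha M \<Delta> u \<noteq> \<one>"
    using assms alpha_M_red alpha_ne_one by auto
  then have "0 < l (alpha M \<Delta> u)" by (intro length_pos M_red_closed)
  also have "\<dots> \<le> l \<Delta>" using a by (intro length_mono M_red_divides M_red_closed)
  finally show ?thesis .
qed

text \<open>The sequence \<open>\<iota>\<^sub>3(1)\<close> is the exceptional \<open>({1})\<close>; no other element has \<open>{1}\<close> as first
  term, because the members of \<open>Pref\<^sub>1\<close> have length \<open>1\<close>.\<close>

lemma iota3_agree_ne_one: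
  assumes "u \<noteq> v" "m > 0"
    and "m \<le> length (iota3 M l u)" "m \<le> length (iota3 M l v)"
    and "take m (iota3 M l u) = take m (iota3 M l v)"
  shows "u \<noteq> \<one>"
proof
  assume "u = \<one>"
  then have "v \<noteq> \<one>" and u: "iota3 M l u ! 0 = {\<one>}"
    using assms(1) by (auto simp: iota3_def)
  then have "iota3 M l v ! 0 = Pref M l 1 v" using assms by (simp add: nth_iota3 length_iota3)
  moreover have "iota3 M l u ! 0 = iota3 M l v ! 0"
    using assms(2,5) by (metis nth_take)
  ultimately have "\<one> \<in> Pref M l 1 v" using u by auto
  then show False by (simp add: Pref_def)
qed

lemma greedy_product_divides_if_iota3_agree:
  assumes u: "u \<in> carrier M" "u \<noteq> \<one>" and v: "v \<in> carrier M" "v \<noteq> \<one>"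
    and len: "m \<le> l u" "m \<le> l v"
    and agree: "take m (iota3 M l u) = take m (iota3 M l v)"
    and j: "j * l \<Delta> \<le> m" "j \<le> length (iota1 M \<Delta> u)"
  shows "list_product M (take j (iota1 M \<Delta> u)) divides list_product M (take j (iota1 M \<Delta> v))"
proof -
  define us where "us = take j (iota1 M \<Delta> u)"
  define p where "p = list_product M us"
  have us: "set us \<subseteq> M_red M \<Delta>" "length us = j"
    using j iota1_M_red[OF u(1)] set_take_subset[of j "iota1 M \<Delta> u"] by (auto simp: us_def)
  have p: "p \<in> carrier M" using u by (simp add: p_def us_def list_product_take_iota1_closed)
  have "p divides u" using u by (simp add: p_def us_def greedy_iota1 greedy_take_divides)
  have "l p \<le> m" using length_simple_product_le[OF us(1)] us(2) j by (simp add: p_def)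
  have "p divides v"
  proof (cases "p = \<one>")
    case True
    then show ?thesis using v by (simp add: one_divides)
  next
    case False
    then obtain i where i: "l p = Suc i" using length_pos[OF p] gr0_conv_Suc by blast
    then have "take m (iota3 M l u) ! i = Pref M l (l p) u"
      "take m (iota3 M l v) ! i = Pref M l (l p) v"
      using \<open>l p \<le> m\<close> len u v by (simp_all add: nth_iota3)
    then have "Pref M l (l p) u = Pref M l (l p) v" using agree by simp
    then show ?thesis using p \<open>p divides u\<close> by (auto simp: Pref_def)
  qed
  then show ?thesis
    using greedy_absorbs_simple_product[OF greedy_iota1[OF v(1)] us(1)] us(2)
    by (simp add: p_def us_def)
qed

lemma agreement_iota3_imp_iota1:
  assumes u: "u \<in> carrier M" and v: "v \<in> carrier M"
    and "enat (n * l \<Delta>) \<le> agreement (iota3 M l) u v"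
  shows "enat n \<le> agreement (iota1 M \<Delta>) u v"
proof (cases "u = v \<or> n = 0")
  case True
  then show ?thesis by (auto simp: enat_le_agreement_iff)
next
  case False
  define m where "m = n * l \<Delta>"
  have m: "m \<le> length (iota3 M l u)" "m \<le> length (iota3 M l v)"
    and agree: "take m (iota3 M l u) = take m (iota3 M l v)"
    using assms(3) False by (auto simp: enat_le_agreement_iff m_def)
  have "l \<Delta> > 0" using length_Delta_pos u v False by blast
  then have "m > 0" using False by (simp add: m_def)
  have ne: "u \<noteq> \<one>" "v \<noteq> \<one>"
    using iota3_agree_ne_one[of u v m] iota3_agree_ne_one[of v u m] m agree \<open>m > 0\<close> False by auto
  have len: "m \<le> l u" "m \<le> l v" using m ne by (simp_all add: length_iota3)
  have long: "n \<le> length (iota1 M \<Delta> w)" if "w \<in> carrier M" "m \<le> l w" for w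
  proof -
    have "l w \<le> length (iota1 M \<Delta> w) * l \<Delta>"
      using length_simple_product_le[of "iota1 M \<Delta> w"] iota1_M_red[of w] that
      by (auto simp: list_product_iota1)
    with that \<open>l \<Delta> > 0\<close> show ?thesis by (auto simp: m_def dest: order_trans)
  qed
  note n = long[OF u len(1)] long[OF v len(2)]
  have eq: "list_product M (take j (iota1 M \<Delta> u)) = list_product M (take j (iota1 M \<Delta> v))"
    if "j \<le> n" for j
  proof (rule divides_antisym)
    have "j * l \<Delta> \<le> m" using that by (simp add: m_def)
    then show "list_product M (take j (iota1 M \<Delta> u)) divides list_product M (take j (iota1 M \<Delta> v))"
      "list_product M (take j (iota1 M \<Delta> v)) divides list_product M (take j (iota1 M \<Delta> u))"
      using u v ne len agree n that
      by (auto intro!: greedy_product_divides_if_iota3_agree[where m = m])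
  qed (simp_all add: list_product_take_iota1_closed u v)
  have "take n (iota1 M \<Delta> u) = take n (iota1 M \<Delta> v)"
  proof (rule nth_equalityI)
    show "length (take n (iota1 M \<Delta> u)) = length (take n (iota1 M \<Delta> v))"
      using n by simp
    fix i assume "i < length (take n (iota1 M \<Delta> u))"
    then have i: "i < n" by simp
    have step: "list_product M (take (Suc i) (iota1 M \<Delta> w)) =
        list_product M (take i (iota1 M \<Delta> w)) \<otimes> iota1 M \<Delta> w ! i"
      and mem: "iota1 M \<Delta> w ! i \<in> carrier M"
      if "w \<in> carrier M" "n \<le> length (iota1 M \<Delta> w)" for w
    proof -
      have i': "i < length (iota1 M \<Delta> w)" using i that by simp
      have closed: "set (iota1 M \<Delta> w) \<subseteq> carrier M" using that greedy_closed greedy_iota1 by blast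
      then show "iota1 M \<Delta> w ! i \<in> carrier M" using nth_mem[OF i'] by blast
      then show "list_product M (take (Suc i) (iota1 M \<Delta> w)) =
        list_product M (take i (iota1 M \<Delta> w)) \<otimes> iota1 M \<Delta> w ! i"
        using closed set_take_subset[of i "iota1 M \<Delta> w"]
        by (subst take_Suc_conv_app_nth[OF i'], subst list_product_append) auto
    qed
    have "list_product M (take i (iota1 M \<Delta> u)) \<otimes> iota1 M \<Delta> u ! i =
        list_product M (take i (iota1 M \<Delta> u)) \<otimes> iota1 M \<Delta> v ! i"
      using eq[of i] eq[of "Suc i"] i step[OF u n(1)] step[OF v n(2)] by simp
    then have "iota1 M \<Delta> u ! i = iota1 M \<Delta> v ! i"
      using mem[OF u n(1)] mem[OF v n(2)] list_product_take_iota1_closed[OF u]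
      by (simp add: l_cancel)
    then show "take n (iota1 M \<Delta> u) ! i = take n (iota1 M \<Delta> v) ! i" using i by simp
  qed
  with n show ?thesis by (simp add: enat_le_agreement_iff)
qed

end

theorem theorem3p13:
  fixes M :: "('a, 'b) monoid_scheme" and \<Delta> :: 'a and l :: "'a \<Rightarrow> nat"
  assumes "garside_monoid M \<Delta>"
    and "finitely_generated M"
    and "is_length M l"
  shows "uniformly_equivalent (carrier M) (d1 M \<Delta>) (d3 M l)"
proof -
  interpret garside_monoid_with_length M \<Delta> l
    using assms by (simp add: garside_monoid_with_length_def garside_monoid_with_length_axioms_def)
  show ?thesis
    unfolding uniformly_equivalent_def d1_def d3_def
  proof (intro conjI Metric_space_agreement_dist)
    show "uniformly_continuous_map (metric (carrier M, agreement_dist (iota1 M \<Delta>)))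
        (metric (carrier M, agreement_dist (iota3 M l))) id"
      by (rule uniformly_continuous_agreement_dist[where f = "\<lambda>n. n"])
        (rule agreement_iota1_imp_iota3)
    show "uniformly_continuous_map (metric (carrier M, agreement_dist (iota3 M l)))
        (metric (carrier M, agreement_dist (iota1 M \<Delta>))) id"
      by (rule uniformly_continuous_agreement_dist[where f = "\<lambda>n. n * l \<Delta>"])
        (rule agreement_iota3_imp_iota1)
  qed
qed

end
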